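(* Let $X$ be a topological space. The following conditions are equivalent. (1) The space $X$ is $T_1$. (2) The space $\mathit{FP}(X)$ is $T_1$. (3) The subspace $X$ of $\mathit{FP}(X)$ is closed. (4) The subspace $X^{-1}$ of $\mathit{FP}(X)$ is discrete. (5) The subspace $X^{-1}$ of $\mathit{FP}(X)$ is $T_1$. (6) The subspace $X^{-1}$ of $\mathit{FP}(X)$ is closed. (7) The subspace $\mathit{FP}_n(X)$ of $\mathit{FP}(X)$ is closed for all $n\in\mathbb{N}$. (8) The subspace $\mathit{FP}_n(X)$ of $\mathit{FP}(X)$ is closed for some $n\in\mathbb{N}$.
   Context: A paratopological group is a group $G$ with a topology such that multiplication $G\times G\to G$ is continuous. (Inversion need not be continuous, and no separation axiom is assumed.) For a topological space $X$, the (Markov) free paratopological group $\mathit{FP}(X)$ on $X$ is a paratopological group that contains $X$ as a topological subspace, is generated algebraically by $X$, and is such that every continuous map $f:X\to H$ into an arbitrary paratopological group $H$ extends to a continuous homomorphism $\hat f:\mathit{FP}(X)\to H$. It exists for every space $X$, and its underlying abstract group is the free group $F_a(X)$ on the set $X$. $X^{-1}=\{x^{-1}:x\in X\}\subseteq \mathit{FP}(X)$. $\mathit{FP}_n(X)$ denotes the subspace of $\mathit{FP}(X)$ consisting of all elements whose reduced word over $X\cup X^{-1}$ has length at most $n$. In (3), (6), (7), (8), "closed" means closed as a subset of $\mathit{FP}(X)$. *)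

theory Defs
  imports "HOL-Analysis.Analysis" "HOL-Algebra.Generated_Groups" "HOL-Algebra.Elementary_Groups"
begin

section \<open>Paratopological groups\<close>

definition paratopological_group :: "('g, 'm) monoid_scheme \<Rightarrow> 'g topology \<Rightarrow> bool" where
  "paratopological_group G T \<longleftrightarrow>
     group G \<and> topspace T = carrier G \<and>
     continuous_map (prod_topology T T) T (\<lambda>(x, y). x \<otimes>\<^bsub>G\<^esub> y)"


section \<open>Reduced words\<close>

text \<open>The pair \<open>(x, True)\<close> stands for the letter \<open>x\<close>, and \<open>(x, False)\<close> for \<open>x\<close> inverse.\<close>

type_synonym 'a word = "('a \<times> bool) list"

definition flip :: "'a \<times> bool \<Rightarrow> 'a \<times> bool" where
  "flip l = (fst l, \<not> snd l)"

definition reduced_word :: "'a word \<Rightarrow> bool" where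
  "reduced_word w \<longleftrightarrow> successively (\<lambda>l m. m \<noteq> flip l) w"

definition reduced_words :: "'a set \<Rightarrow> 'a word set" where
  "reduced_words A = {w. set w \<subseteq> A \<times> UNIV \<and> reduced_word w}"

definition letter_value :: "('g, 'm) monoid_scheme \<Rightarrow> ('a \<Rightarrow> 'g) \<Rightarrow> 'a \<times> bool \<Rightarrow> 'g" where
  "letter_value G f l = (if snd l then f (fst l) else inv\<^bsub>G\<^esub> (f (fst l)))"

definition word_value :: "('g, 'm) monoid_scheme \<Rightarrow> ('a \<Rightarrow> 'g) \<Rightarrow> 'a word \<Rightarrow> 'g" where
  "word_value G f w = foldr (\<lambda>l g. letter_value G f l \<otimes>\<^bsub>G\<^esub> g) w \<one>\<^bsub>G\<^esub>"


section \<open>Free paratopological groups\<close>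

text \<open>
  \<open>free_paratopological_group X G T i\<close>: the group \<open>G\<close> with the topology \<open>T\<close> is a (Markov) free
  paratopological group on \<open>X\<close>, which it contains through the embedding \<open>i\<close> (take the identity
  for \<open>i\<close> if \<open>X\<close> is literally a subspace).

  A formula cannot quantify over types, so the test groups \<open>H\<close> live on the type of words over
  \<open>'a\<close>.  This is no restriction: by \<open>free_paratopological_group_universal\<close> below, the extension
  property follows for paratopological groups on every type.  Existence is
  \<open>free_paratopological_group_exists\<close>.
\<close>

definition free_paratopological_group ::
  "'a topology \<Rightarrow> ('g, 'm) monoid_scheme \<Rightarrow> 'g topology \<Rightarrow> ('a \<Rightarrow> 'g) \<Rightarrow> bool" where
  "free_paratopological_group X G T i \<longleftrightarrow>
     paratopological_group G T \<and>
     embedding_map X T i \<and>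
     generate G (i ` topspace X) = carrier G \<and>
     (\<forall>(H :: 'a word monoid) S f.
        paratopological_group H S \<and> continuous_map X S f \<longrightarrow>
        (\<exists>h. h \<in> hom G H \<and> continuous_map T S h \<and> (\<forall>x\<in>topspace X. h (i x) = f x)))"

text \<open>\<open>FP_le X G i n\<close> is the set of the elements whose reduced word has length at most \<open>n\<close>.\<close>

definition FP_le :: "'a topology \<Rightarrow> ('g, 'm) monoid_scheme \<Rightarrow> ('a \<Rightarrow> 'g) \<Rightarrow> nat \<Rightarrow> 'g set" where
  "FP_le X G i n = word_value G i ` {w \<in> reduced_words (topspace X). length w \<le> n}"


section \<open>The free group of reduced words\<close>

definition push :: "'a \<times> bool \<Rightarrow> 'a word \<Rightarrow> 'a word" where
  "push l w = (case w of [] \<Rightarrow> [l] | m # v \<Rightarrow> if m = flip l then v else l # w)"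

definition free_group :: "'a set \<Rightarrow> 'a word monoid" where
  "free_group A = \<lparr>carrier = reduced_words A, monoid.mult = foldr push, one = []\<rparr>"

lemma free_group_simps [simp]:
  "carrier (free_group A) = reduced_words A"
  "x \<otimes>\<^bsub>free_group A\<^esub> y = foldr push x y"
  "\<one>\<^bsub>free_group A\<^esub> = []"
  by (simp_all add: free_group_def)

lemma flip_flip [simp]: "flip (flip l) = l" and fst_flip [simp]: "fst (flip l) = fst l"
  by (simp_all add: flip_def)

lemma reduced_Nil [simp]: "reduced_word []"
  by (simp add: reduced_word_def)

lemma reduced_Cons: "reduced_word (l # w) \<longleftrightarrow> reduced_word w \<and> (w = [] \<or> hd w \<noteq> flip l)"
  by (auto simp: reduced_word_def successively_Cons)

lemma push_reduced: "reduced_word w \<Longrightarrow> reduced_word (push l w)"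
  by (auto simp: push_def reduced_Cons split: list.splits)

lemma push_eq_Cons: "reduced_word (l # w) \<Longrightarrow> push l w = l # w"
  by (auto simp: push_def reduced_Cons split: list.splits)

lemma push_flip: "reduced_word w \<Longrightarrow> push l (push (flip l) w) = w"
  by (auto simp: push_def reduced_Cons split: list.splits)

lemma set_push: "set (push l w) \<subseteq> insert l (set w)"
  by (auto simp: push_def split: list.splits)

lemma push_in: "w \<in> reduced_words A \<Longrightarrow> fst l \<in> A \<Longrightarrow> push l w \<in> reduced_words A"
  using set_push[of l w] by (auto simp: reduced_words_def push_reduced mem_Times_iff)

lemma foldr_push_in:
  "set u \<subseteq> A \<times> UNIV \<Longrightarrow> w \<in> reduced_words A \<Longrightarrow> foldr push u w \<in> reduced_words A"
  by (induction u) (auto intro!: push_in)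

lemma foldr_push_reduced: "reduced_word w \<Longrightarrow> reduced_word (foldr push u w)"
  by (induction u) (auto simp: push_reduced)

lemma foldr_push_push:
  assumes "reduced_word z"
  shows "foldr push (push l y) z = push l (foldr push y z)"
proof (cases y)
  case (Cons m v)
  show ?thesis
  proof (cases "m = flip l")
    case True
    then show ?thesis
      using Cons push_flip[OF foldr_push_reduced[OF assms], of l v] by (simp add: push_def)
  qed (simp add: Cons push_def)
qed (simp add: push_def)

lemma foldr_push_assoc:
  "reduced_word z \<Longrightarrow> foldr push (foldr push x y) z = foldr push x (foldr push y z)"
  by (induction x) (auto simp: foldr_push_push)

lemma foldr_push_inverse: "reduced_word w \<Longrightarrow> foldr push (rev (map flip w)) w = []"
proof (induction w)
  case (Cons l w)
  have "push (flip l) (l # w) = w"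
    by (simp add: push_def)
  then show ?case
    using Cons by (simp add: reduced_Cons)
qed simp

lemma reduced_inverse: "reduced_word w \<Longrightarrow> reduced_word (rev (map flip w))"
  unfolding reduced_word_def successively_rev successively_map
  by (erule successively_mono) (auto simp: flip_def prod_eq_iff)

lemma inverse_in: "w \<in> reduced_words A \<Longrightarrow> rev (map flip w) \<in> reduced_words A"
  by (auto simp: reduced_words_def reduced_inverse mem_Times_iff subset_iff flip_def simp del: rev_map)

lemma group_free_group: "group (free_group A)"
proof (rule groupI)
  fix x y z assume xyz: "x \<in> carrier (free_group A)" "y \<in> carrier (free_group A)"
    "z \<in> carrier (free_group A)"
  show "x \<otimes>\<^bsub>free_group A\<^esub> y \<in> carrier (free_group A)"
    using xyz by (auto simp: reduced_words_def intro!: foldr_push_in[unfolded reduced_words_def, simplified])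
  show "x \<otimes>\<^bsub>free_group A\<^esub> y \<otimes>\<^bsub>free_group A\<^esub> z = x \<otimes>\<^bsub>free_group A\<^esub> (y \<otimes>\<^bsub>free_group A\<^esub> z)"
    using xyz by (simp add: foldr_push_assoc reduced_words_def)
next
  fix x assume "x \<in> carrier (free_group A)"
  then show "\<exists>y\<in>carrier (free_group A). y \<otimes>\<^bsub>free_group A\<^esub> x = \<one>\<^bsub>free_group A\<^esub>"
    by (intro bexI[of _ "rev (map flip x)"])
       (use foldr_push_inverse[of x] inverse_in[of x A] in \<open>auto simp: reduced_words_def\<close>)
qed (auto simp: reduced_words_def)

lemma letter_in:
  assumes "group H" "f \<in> A \<rightarrow> carrier H" "fst l \<in> A"
  shows "letter_value H f l \<in> carrier H"
  using assms by (auto simp: letter_value_def group.inv_closed Pi_iff)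

lemma word_value_in:
  assumes "group H" "f \<in> A \<rightarrow> carrier H" "set w \<subseteq> A \<times> UNIV"
  shows "word_value H f w \<in> carrier H"
proof -
  interpret group H by fact
  show ?thesis
    using assms(3) by (induction w)
      (auto simp: word_value_def mem_Times_iff intro!: letter_in[OF assms(1,2)])
qed

lemma word_value_push:
  assumes "group H" "f \<in> A \<rightarrow> carrier H" "set w \<subseteq> A \<times> UNIV" "fst l \<in> A"
  shows "word_value H f (push l w) = letter_value H f l \<otimes>\<^bsub>H\<^esub> word_value H f w"
proof (cases "\<exists>v. w = flip l # v")
  case True
  then obtain v where w: "w = flip l # v" by blast
  interpret group H by fact
  have v: "word_value H f v \<in> carrier H"
    using assms(3) w by (intro word_value_in[OF assms(1,2)]) auto
  have l: "f (fst l) \<in> carrier H" using assms(2,4) by auto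
  have "letter_value H f l \<otimes>\<^bsub>H\<^esub> (letter_value H f (flip l) \<otimes>\<^bsub>H\<^esub> word_value H f v)
      = word_value H f v"
    using v l by (simp add: letter_value_def flip_def m_assoc[symmetric])
  then show ?thesis by (simp add: w push_def word_value_def)
next
  case False
  then have "push l w = l # w" by (auto simp: push_def split: list.splits)
  then show ?thesis by (simp add: word_value_def)
qed

lemma word_value_mult:
  assumes "group H" "f \<in> A \<rightarrow> carrier H" "set u \<subseteq> A \<times> UNIV" "v \<in> reduced_words A"
  shows "word_value H f (foldr push u v) = word_value H f u \<otimes>\<^bsub>H\<^esub> word_value H f v"
proof -
  interpret group H by fact
  have v: "word_value H f v \<in> carrier H"
    using assms by (intro word_value_in[OF assms(1,2)]) (auto simp: reduced_words_def)
  show ?thesis using assms(3)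
  proof (induction u)
    case Nil
    then show ?case using v by (simp add: word_value_def)
  next
    case (Cons l u)
    have "foldr push u v \<in> reduced_words A"
      using Cons.prems assms(4) by (intro foldr_push_in) auto
    then have "word_value H f (push l (foldr push u v))
        = letter_value H f l \<otimes>\<^bsub>H\<^esub> word_value H f (foldr push u v)"
      using Cons.prems by (intro word_value_push[OF assms(1,2)]) (auto simp: reduced_words_def)
    also have "\<dots> = letter_value H f l \<otimes>\<^bsub>H\<^esub> word_value H f u \<otimes>\<^bsub>H\<^esub> word_value H f v"
      using Cons v letter_in[OF assms(1,2), of l] word_value_in[OF assms(1,2), of u]
      by (simp add: m_assoc mem_Times_iff)
    finally show ?case by (simp add: word_value_def)
  qed
qed

lemma word_value_hom:
  assumes "group H" "f \<in> A \<rightarrow> carrier H"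
  shows "word_value H f \<in> hom (free_group A) H"
  by (rule homI)
     (auto simp: reduced_words_def intro!: word_value_in[OF assms] word_value_mult[OF assms])

lemma word_value_letter:
  assumes "group H" "f \<in> A \<rightarrow> carrier H" "x \<in> A"
  shows "word_value H f [(x, True)] = f x"
proof -
  interpret group H by fact
  have "f x \<in> carrier H" using assms(2,3) by auto
  then show ?thesis by (simp add: word_value_def letter_value_def)
qed

abbreviation (input) letter :: "'a \<Rightarrow> 'a word" where
  "letter \<equiv> \<lambda>x. [(x, True)]"

lemma letter_in_words: "x \<in> A \<Longrightarrow> [(x, b)] \<in> reduced_words A"
  by (auto simp: reduced_words_def reduced_Cons)

lemma inv_letter: "x \<in> A \<Longrightarrow> inv\<^bsub>free_group A\<^esub> [(x, True)] = [(x, False)]"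
  by (rule group.inv_equality[OF group_free_group])
     (auto simp: letter_in_words push_def flip_def)

lemma generate_free_group: "generate (free_group A) (letter ` A) = carrier (free_group A)"
proof
  show "generate (free_group A) (letter ` A) \<subseteq> carrier (free_group A)"
    by (rule group.generate_incl[OF group_free_group]) (auto simp: letter_in_words)
  have "w \<in> generate (free_group A) (letter ` A)" if "w \<in> reduced_words A" for w
    using that
  proof (induction w)
    case Nil
    then show ?case using generate.one[of "free_group A"] by simp
  next
    case (Cons l w)
    have w: "w \<in> reduced_words A" and l: "fst l \<in> A" and red: "reduced_word (l # w)"
      using Cons.prems by (auto simp: reduced_words_def reduced_Cons)
    have "[l] \<in> generate (free_group A) (letter ` A)"
    proof (cases "snd l")
      case True
      then have "[l] = letter (fst l)" by (simp add: prod_eq_iff)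
      with l show ?thesis by (metis generate.incl imageI)
    next
      case False
      then have "[l] = inv\<^bsub>free_group A\<^esub> (letter (fst l))" using l by (simp add: inv_letter prod_eq_iff)
      with l show ?thesis by (metis (no_types, lifting) generate.inv imageI)
    qed
    from generate.eng[OF this Cons.IH[OF w]] show ?case
      using red by (simp add: push_eq_Cons)
  qed
  then show "carrier (free_group A) \<subseteq> generate (free_group A) (letter ` A)" by auto
qed


section \<open>Existence, and the universal property for all types\<close>

lemma paratopological_group_pullback:
  assumes H: "paratopological_group H S" and F: "group F" and h: "h \<in> hom F H"
  shows "paratopological_group F (pullback_topology (carrier F) h S)"
proof -
  let ?P = "pullback_topology (carrier F) h S"
  have top: "topspace ?P = carrier F"
    using H h by (auto simp: topspace_pullback_topology paratopological_group_def hom_def)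
  have hc: "continuous_map ?P S h"
    by (metis continuous_map_pullback continuous_map_id id_o)
  have "continuous_map (prod_topology ?P ?P) (prod_topology S S) (\<lambda>z. (h (fst z), h (snd z)))"
    by (intro continuous_map_pairedI continuous_map_compose[OF continuous_map_fst hc, unfolded o_def]
        continuous_map_compose[OF continuous_map_snd hc, unfolded o_def])
  moreover have "continuous_map (prod_topology S S) S (\<lambda>(x, y). x \<otimes>\<^bsub>H\<^esub> y)"
    using H by (simp add: paratopological_group_def)
  ultimately have "continuous_map (prod_topology ?P ?P) S
      ((\<lambda>(x, y). x \<otimes>\<^bsub>H\<^esub> y) \<circ> (\<lambda>z. (h (fst z), h (snd z))))"
    by (rule continuous_map_compose)
  then have "continuous_map (prod_topology ?P ?P) S (h \<circ> (\<lambda>(x, y). x \<otimes>\<^bsub>F\<^esub> y))"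
    by (rule continuous_map_eq) (use h top in \<open>auto simp: hom_def\<close>)
  then have "continuous_map (prod_topology ?P ?P) ?P (\<lambda>(x, y). x \<otimes>\<^bsub>F\<^esub> y)"
    by (rule continuous_map_pullback')
       (use F top in \<open>auto simp: group.is_monoid monoid.m_closed\<close>)
  with F top show ?thesis by (simp add: paratopological_group_def)
qed

text \<open>The finest paratopological group topology on the free group for which the inclusion of the
  generators is continuous, i.e. the join of all such topologies.\<close>

definition free_topology :: "'a topology \<Rightarrow> 'a word topology" where
  "free_topology X = topology_generated_by
     (\<Union>T\<in>{T. paratopological_group (free_group (topspace X)) T \<and> continuous_map X T letter}.
        {U. openin T U})"

lemma openin_free_topology:
  "paratopological_group (free_group (topspace X)) T \<Longrightarrow> continuous_map X T letter \<Longrightarrow>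
   openin T U \<Longrightarrow> openin (free_topology X) U"
  unfolding free_topology_def by (rule topology_generated_by_Basis) auto

lemma trivial_topology_admissible:
  fixes X :: "'a topology"
  defines "F \<equiv> free_group (topspace X)"
  shows "paratopological_group F (pullback_topology (carrier F) (\<lambda>_. 0) (discrete_topology {0::int}))"
    (is "paratopological_group F ?P")
    and "continuous_map X (pullback_topology (carrier F) (\<lambda>_. 0) (discrete_topology {0::int})) letter"
proof -
  have F: "group F" by (simp add: F_def group_free_group)
  have top: "topspace ?P = carrier F" by (auto simp: topspace_pullback_topology)
  have "continuous_map (prod_topology ?P ?P) ?P (\<lambda>(x, y). x \<otimes>\<^bsub>F\<^esub> y)"
    by (rule continuous_map_pullback')
       (use F top in \<open>auto simp: group.is_monoid monoid.m_closed o_def\<close>)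
  with F top show "paratopological_group F ?P" by (simp add: paratopological_group_def)
  show "continuous_map X ?P letter"
    by (rule continuous_map_pullback') (auto simp: o_def F_def letter_in_words)
qed

lemma topspace_free_topology: "topspace (free_topology X) = reduced_words (topspace X)"
proof
  show "topspace (free_topology X) \<subseteq> reduced_words (topspace X)"
    unfolding free_topology_def topology_generated_by_topspace
    by (auto simp: paratopological_group_def dest: openin_subset)
  show "reduced_words (topspace X) \<subseteq> topspace (free_topology X)"
    using openin_free_topology[OF trivial_topology_admissible openin_topspace]
    by (metis (no_types, lifting) free_group_simps(1) openin_subset paratopological_group_def
        trivial_topology_admissible(1))
qed

lemma continuous_free_topology_id:
  assumes "paratopological_group (free_group (topspace X)) T" "continuous_map X T letter"
  shows "continuous_map (free_topology X) T (\<lambda>x. x)"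
proof -
  have "topspace T = reduced_words (topspace X)"
    using assms(1) by (simp add: paratopological_group_def)
  moreover have "{x \<in> reduced_words (topspace X). x \<in> U} = U" if "openin T U" for U
    using openin_subset[OF that] calculation by auto
  ultimately show ?thesis
    using openin_free_topology[OF assms]
    by (auto simp: continuous_map_def topspace_free_topology)
qed

lemma continuous_into_free_topology:
  assumes "\<And>T. paratopological_group (free_group (topspace X)) T \<Longrightarrow> continuous_map X T letter
      \<Longrightarrow> continuous_map Y T f"
  shows "continuous_map Y (free_topology X) f"
proof -
  have "f \<in> topspace Y \<rightarrow> reduced_words (topspace X)"
    using assms[OF trivial_topology_admissible]
    by (auto simp: continuous_map_def topspace_pullback_topology)
  moreover have "openin Y (f -` U \<inter> topspace Y)"
    if "paratopological_group (free_group (topspace X)) T" "continuous_map X T letter" "openin T U"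
    for T U
    using assms[OF that(1,2)] that(3) by (simp add: continuous_map_alt)
  ultimately show ?thesis
    using topspace_free_topology[of X]
    unfolding free_topology_def topology_generated_by_topspace
    by (intro continuous_on_generated_topo) auto
qed

lemma paratopological_group_free_topology:
  "paratopological_group (free_group (topspace X)) (free_topology X)"
proof -
  have "continuous_map (prod_topology (free_topology X) (free_topology X)) (free_topology X)
      (\<lambda>(x, y). x \<otimes>\<^bsub>free_group (topspace X)\<^esub> y)"
  proof (rule continuous_into_free_topology)
    fix T assume T: "paratopological_group (free_group (topspace X)) T" "continuous_map X T letter"
    note id = continuous_free_topology_id[OF T]
    have "continuous_map (prod_topology (free_topology X) (free_topology X)) (prod_topology T T)
        (\<lambda>z. (fst z, snd z))"
      by (intro continuous_map_pairedI continuous_map_compose[OF continuous_map_fst id, unfolded o_def]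
        continuous_map_compose[OF continuous_map_snd id, unfolded o_def])
    from continuous_map_compose[OF this]
    show "continuous_map (prod_topology (free_topology X) (free_topology X)) T
      (\<lambda>(x, y). x \<otimes>\<^bsub>free_group (topspace X)\<^esub> y)"
      using T(1) by (fastforce simp: paratopological_group_def o_def)
  qed
  then show ?thesis
    by (simp add: paratopological_group_def group_free_group topspace_free_topology)
qed

lemma free_topology_universal:
  assumes H: "paratopological_group H S" and f: "continuous_map X S f"
  shows "word_value H f \<in> hom (free_group (topspace X)) H"
    and "continuous_map (free_topology X) S (word_value H f)"
    and "\<forall>x\<in>topspace X. word_value H f [(x, True)] = f x"
proof -
  let ?F = "free_group (topspace X)"
  have gH: "group H" and f': "f \<in> topspace X \<rightarrow> carrier H"
    using H f by (auto simp: paratopological_group_def continuous_map_def)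
  show hom: "word_value H f \<in> hom ?F H" by (rule word_value_hom[OF gH f'])
  show letter: "\<forall>x\<in>topspace X. word_value H f [(x, True)] = f x"
    by (simp add: word_value_letter[OF gH f'])
  let ?P = "pullback_topology (carrier ?F) (word_value H f) S"
  have "continuous_map X ?P letter"
    by (rule continuous_map_pullback')
       (auto simp: letter_in_words letter intro!: continuous_map_eq[OF f])
  then have "continuous_map (free_topology X) ?P (\<lambda>x. x)"
    by (intro continuous_free_topology_id paratopological_group_pullback[OF H group_free_group hom])
  moreover have "continuous_map ?P S (word_value H f)"
    by (metis continuous_map_pullback continuous_map_id id_o)
  ultimately show "continuous_map (free_topology X) S (word_value H f)"
    by (auto dest: continuous_map_compose simp: o_def)
qed

text \<open>The integers with the topology of up-sets contain the Sierpinski space, which makes the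
  open subsets of \<open>X\<close> visible.\<close>

definition upper_topology :: "int topology" where
  "upper_topology = topology (\<lambda>U. \<forall>x\<in>U. \<forall>y\<ge>x. y \<in> U)"

lemma openin_upper_topology: "openin upper_topology U \<longleftrightarrow> (\<forall>x\<in>U. \<forall>y\<ge>x. y \<in> U)"
proof -
  have "istopology (\<lambda>U::int set. \<forall>x\<in>U. \<forall>y\<ge>x. y \<in> U)"
    unfolding istopology_def by blast
  then show ?thesis by (simp add: upper_topology_def)
qed

lemma topspace_upper_topology [simp]: "topspace upper_topology = UNIV"
  unfolding topspace_def by (auto simp: openin_upper_topology intro!: exI[of _ UNIV])

lemma paratopological_group_upper_topology: "paratopological_group integer_group upper_topology"
proof -
  have "openin (prod_topology upper_topology upper_topology) {z. fst z + snd z \<in> U}"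
    if U: "openin upper_topology U" for U
    unfolding openin_prod_topology_alt
  proof (intro allI impI)
    fix x y assume "(x, y) \<in> {z. fst z + snd z \<in> U}"
    then have "{x..} \<times> {y..} \<subseteq> {z. fst z + snd z \<in> U}"
      using U unfolding openin_upper_topology by (force intro: add_mono)
    then show "\<exists>V W. openin upper_topology V \<and> openin upper_topology W \<and> x \<in> V \<and> y \<in> W \<and>
        V \<times> W \<subseteq> {z. fst z + snd z \<in> U}"
      by (intro exI[of _ "{x..}"] exI[of _ "{y..}"]) (auto simp: openin_upper_topology)
  qed
  then show ?thesis
    by (auto simp: paratopological_group_def continuous_map_def case_prod_beta)
qed

lemma embedding_letter: "embedding_map X (free_topology X) letter"
proof -
  let ?Y = "subtopology (free_topology X) (letter ` topspace X)"
  have "continuous_map X (free_topology X) letter"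
    by (rule continuous_into_free_topology)
  then have 1: "continuous_map X ?Y letter"
    by (auto simp: continuous_map_in_subtopology)
  have top: "topspace ?Y = letter ` topspace X"
    by (auto simp: topspace_free_topology letter_in_words)
  have "openin ?Y {w \<in> topspace ?Y. fst (hd w) \<in> U}" if U: "openin X U" for U
  proof -
    define f where "f = (\<lambda>x. if x \<in> U then 1 else 0 :: int)"
    have f: "continuous_map X upper_topology f"
      unfolding continuous_map_def
    proof (intro conjI allI impI)
      fix V assume V: "openin upper_topology V"
      have "0 \<in> V \<Longrightarrow> 1 \<in> V" using V by (auto simp: openin_upper_topology)
      then have "{x \<in> topspace X. f x \<in> V} = (if 0 \<in> V then topspace X else if 1 \<in> V then U else {})"
        using openin_subset[OF U] by (auto simp: f_def)
      then show "openin X {x \<in> topspace X. f x \<in> V}" using U by simp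
    qed simp
    note u = free_topology_universal[OF paratopological_group_upper_topology f]
    have "openin upper_topology {1..}" by (auto simp: openin_upper_topology)
    with u(2) have "openin (free_topology X)
        {w \<in> topspace (free_topology X). word_value integer_group f w \<in> {1..}}"
      by (rule openin_continuous_map_preimage)
    moreover have "{w \<in> topspace ?Y. fst (hd w) \<in> U} = letter ` topspace X \<inter>
        {w \<in> topspace (free_topology X). word_value integer_group f w \<in> {1..}}"
      using u(3) unfolding top
      by (auto simp: topspace_free_topology letter_in_words f_def split: if_splits)
    ultimately show ?thesis
      by (metis (no_types, lifting) openin_subtopology_Int2)
  qed
  moreover have "(\<lambda>w. fst (hd w)) \<in> topspace ?Y \<rightarrow> topspace X"
    unfolding top by auto
  ultimately have "continuous_map ?Y X (\<lambda>w. fst (hd w))"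
    unfolding continuous_map_def by blast
  with 1 have "homeomorphic_maps X ?Y letter (\<lambda>w. fst (hd w))"
    by (auto simp: homeomorphic_maps_def)
  then show ?thesis
    unfolding embedding_map_def homeomorphic_map_maps by blast
qed

theorem free_paratopological_group_exists:
  "free_paratopological_group X (free_group (topspace X)) (free_topology X) (\<lambda>x. [(x, True)])"
  unfolding free_paratopological_group_def
  using paratopological_group_free_topology embedding_letter generate_free_group
    free_topology_universal
  by (smt (verit) image_cong)

theorem free_paratopological_group_universal:
  fixes X :: "'a topology" and H :: "('h, 'n) monoid_scheme"
  assumes G: "free_paratopological_group X G T i"
    and H: "paratopological_group H S" and f: "continuous_map X S f"
  shows "\<exists>h. h \<in> hom G H \<and> continuous_map T S h \<and> (\<forall>x\<in>topspace X. h (i x) = f x)"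
proof -
  have "continuous_map X (free_topology X) letter"
    by (rule continuous_into_free_topology)
  then obtain g where g: "g \<in> hom G (free_group (topspace X))" "continuous_map T (free_topology X) g"
      "\<forall>x\<in>topspace X. g (i x) = [(x, True)]"
    using G paratopological_group_free_topology unfolding free_paratopological_group_def by blast
  note u = free_topology_universal[OF H f]
  show ?thesis
    using hom_compose[OF g(1) u(1)] continuous_map_compose[OF g(2) u(2)] g(3) u(3)
    by (intro exI[of _ "word_value H f \<circ> g"]) simp
qed

end

theory Submission
  imports Defs
begin

text \<open>
  The order automorphisms of the real line, with the up-sets of the pointwise order as open sets,
  form a paratopological group.  A map into it that takes a fixed maximal value outside a finite
  subset of a \<open>T\<^sub>1\<close> space is continuous.  For a reduced word \<open>w\<close> of length \<open>m\<close> send the letters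
  outside \<open>w\<close> to the shift \<open>t + 1\<close> and the letters of \<open>w\<close> to automorphisms that move every point by
  at most 1 and make \<open>w\<close> climb from 0 to \<open>m\<close> step by step; this is consistent because \<open>w\<close> is reduced.
  Shorter words cannot carry 0 to \<open>m\<close>, so the automorphisms \<open>h\<close> with \<open>h 0 \<ge> m\<close> pull back to a
  neighbourhood of \<open>w\<close> that contains no shorter word.  Hence the words of length at most \<open>n\<close> form a
  closed set.  Conversely, if \<open>x \<noteq> y\<close> and \<open>x\<close> is in the closure of \<open>y\<close>, then \<open>y\<^sup>-\<^sup>1 x\<close> is in the closure
  of the unit, and translating it produces words in closures that are too long.
\<close>

section \<open>Order automorphisms\<close>

definition order_aut_group :: "('b::order \<Rightarrow> 'b) monoid" where
  "order_aut_group = \<lparr>carrier = {f. bij f \<and> (\<forall>s t. f s \<le> f t \<longleftrightarrow> s \<le> t)}, monoid.mult = (\<circ>), one = id\<rparr>"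

text \<open>An Alexandrov topology: the smallest neighbourhood of \<open>f\<close> consists of the
  automorphisms above \<open>f\<close>. Taking inverses reverses the order, so inversion is in
  general not continuous.\<close>

definition order_aut_topology :: "('b::order \<Rightarrow> 'b) topology" where
  "order_aut_topology = topology (\<lambda>U. U \<subseteq> carrier order_aut_group \<and>
     (\<forall>f\<in>U. \<forall>g\<in>carrier order_aut_group. f \<le> g \<longrightarrow> g \<in> U))"

lemma order_aut_group_simps [simp]:
  "f \<in> carrier order_aut_group \<longleftrightarrow> bij f \<and> (\<forall>s t. f s \<le> f t \<longleftrightarrow> s \<le> t)"
  "f \<otimes>\<^bsub>order_aut_group\<^esub> g = f \<circ> g"
  "\<one>\<^bsub>order_aut_group\<^esub> = id"
  by (simp_all add: order_aut_group_def)

lemma inv_into_order_aut: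
  fixes f :: "'b::order \<Rightarrow> 'b"
  assumes "f \<in> carrier order_aut_group"
  shows "inv_into UNIV f \<in> carrier order_aut_group"
proof -
  have f: "bij f" "\<And>s t. f s \<le> f t \<longleftrightarrow> s \<le> t" using assms by auto
  then have "inv_into UNIV f s \<le> inv_into UNIV f t \<longleftrightarrow> s \<le> t" for s t
    by (metis bij_inv_eq_iff)
  with f(1) show ?thesis by (simp add: bij_imp_bij_inv)
qed

lemma group_order_aut_group: "group (order_aut_group :: ('b::order \<Rightarrow> 'b) monoid)"
proof (rule groupI)
  fix f :: "'b \<Rightarrow> 'b" assume f: "f \<in> carrier order_aut_group"
  then have "inv_into UNIV f \<circ> f = id" by (simp add: bij_is_inj)
  with inv_into_order_aut[OF f]
  show "\<exists>g\<in>carrier order_aut_group. g \<otimes>\<^bsub>order_aut_group\<^esub> f = \<one>\<^bsub>order_aut_group\<^esub>"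
    by (metis order_aut_group_simps(2,3))
qed (auto simp: bij_comp o_assoc)

lemma inv_order_aut_group:
  assumes "f \<in> carrier order_aut_group"
  shows "inv\<^bsub>order_aut_group\<^esub> f = inv_into UNIV f"
proof (rule group.inv_equality[OF group_order_aut_group])
  show "inv_into UNIV f \<otimes>\<^bsub>order_aut_group\<^esub> f = \<one>\<^bsub>order_aut_group\<^esub>"
    using assms by (simp add: bij_is_inj)
qed (use assms inv_into_order_aut in blast)+

lemma openin_order_aut_topology:
  fixes U :: "('b::order \<Rightarrow> 'b) set"
  shows "openin order_aut_topology U \<longleftrightarrow> U \<subseteq> carrier order_aut_group \<and>
     (\<forall>f\<in>U. \<forall>g\<in>carrier order_aut_group. f \<le> g \<longrightarrow> g \<in> U)"
proof -
  have "istopology (\<lambda>U :: ('b \<Rightarrow> 'b) set. U \<subseteq> carrier order_aut_group \<and>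
     (\<forall>f\<in>U. \<forall>g\<in>carrier order_aut_group. f \<le> g \<longrightarrow> g \<in> U))"
    unfolding istopology_def by blast
  then show ?thesis unfolding order_aut_topology_def by (simp only: topology_inverse')
qed

lemma topspace_order_aut_topology: "topspace order_aut_topology = carrier order_aut_group"
  using openin_order_aut_topology openin_subset openin_topspace
  by (metis (no_types, lifting) order_refl subset_antisym)

lemma paratopological_group_order_aut:
  "paratopological_group (order_aut_group :: ('b::order \<Rightarrow> 'b) monoid) order_aut_topology"
proof -
  let ?G = "order_aut_group :: ('b \<Rightarrow> 'b) monoid"
  let ?T = "order_aut_topology :: ('b \<Rightarrow> 'b) topology"
  define up where "up f = {g \<in> carrier ?G. f \<le> g}" for f
  have up: "openin ?T (up f)" for f
    unfolding openin_order_aut_topology up_def by (auto intro: order_trans)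
  have "openin (prod_topology ?T ?T) {z \<in> carrier ?G \<times> carrier ?G. fst z \<circ> snd z \<in> U}"
    if U: "openin ?T U" for U
    unfolding openin_prod_topology_alt
  proof (intro allI impI)
    fix f g assume fg: "(f, g) \<in> {z \<in> carrier ?G \<times> carrier ?G. fst z \<circ> snd z \<in> U}"
    have "f' \<circ> g' \<in> U" if "f' \<in> up f" "g' \<in> up g" for f' g'
    proof -
      \<comment> \<open>The outer map \<open>f\<close> is itself monotone, so composition is
        monotone in both factors.\<close>
      have "f (g s) \<le> f' (g' s)" for s
      proof -
        have "f (g s) \<le> f (g' s)" using fg that by (auto simp: up_def le_fun_def)
        also have "\<dots> \<le> f' (g' s)" using that by (auto simp: up_def le_fun_def)
        finally show ?thesis .
      qed
      moreover have "f' \<circ> g' \<in> carrier ?G" using that by (auto simp: up_def bij_comp)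
      ultimately show ?thesis
        using U fg by (fastforce simp: openin_order_aut_topology le_fun_def)
    qed
    then have "up f \<times> up g \<subseteq> {z \<in> carrier ?G \<times> carrier ?G. fst z \<circ> snd z \<in> U}"
      by (auto simp: up_def)
    moreover have "f \<in> up f" "g \<in> up g" using fg by (auto simp: up_def)
    ultimately show "\<exists>V W. openin ?T V \<and> openin ?T W \<and> f \<in> V \<and> g \<in> W \<and>
        V \<times> W \<subseteq> {z \<in> carrier ?G \<times> carrier ?G. fst z \<circ> snd z \<in> U}"
      using up by blast
  qed
  then have "continuous_map (prod_topology ?T ?T) ?T (\<lambda>(f, g). f \<otimes>\<^bsub>?G\<^esub> g)"
    by (auto simp: continuous_map_def case_prod_beta topspace_order_aut_topology bij_comp)
  then show ?thesis
    by (simp add: paratopological_group_def group_order_aut_group topspace_order_aut_topology)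
qed

text \<open>The gaps 1 and 3 are those that \<open>climbing_step_maps\<close> obtains from reducedness; the slopes 3
  and 1/3 in the induction step are what these gaps allow.\<close>

lemma step_homeomorphism:
  fixes J :: "real set"
  assumes "finite J"
  shows "\<exists>\<phi> :: real \<Rightarrow> real. continuous_on UNIV \<phi> \<and> strict_mono \<phi> \<and>
    (\<forall>t. t - 1 \<le> \<phi> t \<and> \<phi> t \<le> t + 1) \<and> (\<forall>k\<in>J. \<phi> k = k - 1) \<and>
    (\<forall>j. (\<forall>k\<in>J. k \<le> j - 1 \<or> j + 3 \<le> k) \<longrightarrow> \<phi> j = j + 1)"
  using assms
proof induction
  case empty
  show ?case
    by (rule exI[of _ "\<lambda>t. t + 1"]) (auto intro!: continuous_intros strict_monoI)
next
  case (insert k J)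
  then obtain \<phi> :: "real \<Rightarrow> real" where \<phi>: "continuous_on UNIV \<phi>" "strict_mono \<phi>"
    "\<And>t. t - 1 \<le> \<phi> t" "\<And>t. \<phi> t \<le> t + 1" "\<And>k. k \<in> J \<Longrightarrow> \<phi> k = k - 1"
    "\<And>j. (\<forall>k\<in>J. k \<le> j - 1 \<or> j + 3 \<le> k) \<Longrightarrow> \<phi> j = j + 1" by blast
  \<comment> \<open>The graph of \<open>q\<close> passes through the point
    \<open>(k, k - 1)\<close>, with slope 1/3 on its left and 3 on its right. It meets the line
    \<open>t + 1\<close> at \<open>k - 3\<close> and at \<open>k + 1\<close> and stays above it
    beyond these points. As \<open>\<phi>\<close> never exceeds \<open>t + 1\<close>, the minimum
    with \<open>q\<close> keeps the value \<open>t + 1\<close> there, and it forces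
    \<open>k - 1\<close> at \<open>k\<close>.\<close>
  define q where "q t = max (t - 1) (k - 1 + max (3 * (t - k)) ((t - k) / 3))" for t
  have q: "strict_mono q" by (rule strict_monoI) (auto simp: q_def max_def field_simps)
  show ?case
  proof (intro exI[of _ "\<lambda>t. min (\<phi> t) (q t)"] conjI allI impI ballI)
    show "continuous_on UNIV (\<lambda>t. min (\<phi> t) (q t))"
      unfolding q_def by (intro continuous_intros \<phi>(1)) auto
    show "strict_mono (\<lambda>t. min (\<phi> t) (q t))"
      using strict_monoD[OF \<phi>(2)] strict_monoD[OF q] by (intro strict_monoI) (auto simp: min_less_iff_disj)
    fix t show "t - 1 \<le> min (\<phi> t) (q t)" "min (\<phi> t) (q t) \<le> t + 1"
      using \<phi>(3,4)[of t] by (auto simp: q_def)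
  next
    fix k' assume "k' \<in> insert k J"
    then show "min (\<phi> k') (q k') = k' - 1"
      using \<phi>(3)[of k'] \<phi>(5)[of k'] by (auto simp: q_def)
  next
    fix j assume j: "\<forall>k\<in>insert k J. k \<le> j - 1 \<or> j + 3 \<le> k"
    then have "j + 1 \<le> q j" by (auto simp: q_def max_def field_simps)
    with j \<phi>(6)[of j] show "min (\<phi> j) (q j) = j + 1" by simp
  qed
qed

text \<open>Bounded displacement puts \<open>y\<close> between \<open>\<phi> (y - c)\<close> and
  \<open>\<phi> (y + c)\<close>, so surjectivity follows from the intermediate value
  theorem.\<close>

lemma order_aut_of_bounded_displacement:
  fixes \<phi> :: "real \<Rightarrow> real"
  assumes "continuous_on UNIV \<phi>" "strict_mono \<phi>" "\<And>t. t - c \<le> \<phi> t" "\<And>t. \<phi> t \<le> t + c"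
  shows "\<phi> \<in> carrier order_aut_group"
proof -
  have "\<exists>t. \<phi> t = y" for y
  proof -
    have "\<phi> (y - c) \<le> y" "y \<le> \<phi> (y + c)" using assms(3)[of "y + c"] assms(4)[of "y - c"] by auto
    \<comment> \<open>No sign is assumed for \<open>c\<close>; the inequality comes from
      \<open>\<phi> (y - c) \<le> \<phi> (y + c)\<close> by strict monotonicity.\<close>
    moreover from this have "y - c \<le> y + c"
      by (meson assms(2) order_trans strict_mono_less_eq)
    ultimately show ?thesis
      using IVT'[of \<phi> "y - c" y "y + c"] continuous_on_subset[OF assms(1)] by blast
  qed
  then have "surj \<phi>" by (metis surjI)
  with assms(2) show ?thesis by (simp add: bij_def strict_mono_imp_inj_on strict_mono_less_eq)
qed

section \<open>Words of bounded length\<close>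

lemma word_value_simps [simp]:
  "word_value H f [] = \<one>\<^bsub>H\<^esub>"
  "word_value H f (l # w) = letter_value H f l \<otimes>\<^bsub>H\<^esub> word_value H f w"
  by (simp_all add: word_value_def)

lemma reduced_word_rev: "reduced_word w \<Longrightarrow> reduced_word (rev w)"
  unfolding reduced_word_def successively_rev
  by (erule successively_mono) (auto simp: flip_def prod_eq_iff)

lemma reduced_word_nth:
  "reduced_word w \<Longrightarrow> Suc n < length w \<Longrightarrow> w ! Suc n \<noteq> flip (w ! n)"
  unfolding reduced_word_def successively_conv_nth by blast

text \<open>The rightmost letter of \<open>w\<close> acts first, so in the reversed word the letter
  at position \<open>n\<close> must carry \<open>n\<close> to \<open>n + 1\<close>. Each position
  thus prescribes one value of one \<open>f x\<close>, and reducedness keeps the prescriptions for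
  the same \<open>x\<close> compatible.\<close>

lemma climbing_step_maps:
  assumes "reduced_word w"
  obtains f :: "'a \<Rightarrow> real \<Rightarrow> real" where
    "\<And>x. f x \<in> carrier order_aut_group" "\<And>x t. t - 1 \<le> f x t" "\<And>x t. f x t \<le> t + 1"
    "\<And>x. x \<notin> fst ` set w \<Longrightarrow> f x = (\<lambda>t. t + 1)"
    "word_value order_aut_group f w 0 = length w"
proof -
  define v where "v = rev w"
  have v: "reduced_word v" and w: "w = rev v" using reduced_word_rev[OF assms] by (auto simp: v_def)
  \<comment> \<open>An inverse letter at position \<open>n\<close> carries \<open>n\<close> to
    \<open>n + 1\<close> when \<open>f x\<close> carries \<open>n + 1\<close> to \<open>n\<close>;
    hence the points \<open>Suc n\<close>.\<close>
  define J where "J x = (\<lambda>n. real (Suc n)) ` {n. n < length v \<and> v ! n = (x, False)}" for x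
  have "finite (J x)" for x unfolding J_def by simp
  then have "\<exists>\<phi>. \<forall>x. continuous_on UNIV (\<phi> x) \<and> strict_mono (\<phi> x) \<and>
    (\<forall>t. t - 1 \<le> \<phi> x t \<and> \<phi> x t \<le> t + 1) \<and> (\<forall>k\<in>J x. \<phi> x k = k - 1) \<and>
    (\<forall>j. (\<forall>k\<in>J x. k \<le> j - 1 \<or> j + 3 \<le> k) \<longrightarrow> \<phi> x j = j + 1)"
    by (intro choice allI step_homeomorphism)
  then obtain f where f: "\<And>x. continuous_on UNIV (f x)" "\<And>x. strict_mono (f x)"
    "\<And>x t. t - 1 \<le> f x t" "\<And>x t. f x t \<le> t + 1" "\<And>x k. k \<in> J x \<Longrightarrow> f x k = k - 1"
    "\<And>x j. (\<forall>k\<in>J x. k \<le> j - 1 \<or> j + 3 \<le> k) \<Longrightarrow> f x j = j + 1" by metis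
  have aut: "f x \<in> carrier order_aut_group" for x
    by (rule order_aut_of_bounded_displacement[OF f(1-4)])
  have "J x = {}" if "x \<notin> fst ` set w" for x
    using that nth_mem unfolding J_def w by force
  then have out: "f x = (\<lambda>t. t + 1)" if "x \<notin> fst ` set w" for x
    using f(6)[of x] that by (intro ext) simp
  have "word_value order_aut_group f (rev (take n v)) 0 = n" if "n \<le> length v" for n
    using that
  proof (induction n)
    case (Suc n)
    then have n: "n < length v" and IH: "word_value order_aut_group f (rev (take n v)) 0 = n" by auto
    obtain x b where x: "v ! n = (x, b)" by force
    have "letter_value order_aut_group f (x, b) n = Suc n"
    proof (cases b)
      case True
      have "k \<le> real n - 1 \<or> real n + 3 \<le> k" if k: "k \<in> J x" for k
      proof -
        obtain n' where n': "n' < length v" "v ! n' = (x, False)" "k = real (Suc n')"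
          using k by (auto simp: J_def)
        have "n' \<noteq> n" using n' x True by auto
        moreover have "n' \<noteq> Suc n"
          using n' reduced_word_nth[OF v, of n] x True by (auto simp: flip_def)
        moreover have "n \<noteq> Suc n'"
          using n n' reduced_word_nth[OF v, of n'] x True by (auto simp: flip_def)
        \<comment> \<open>A letter and its inverse are never adjacent, so their positions differ by
          at least 2. Since \<open>k\<close> is \<open>n' + 1\<close>, the gap is at least 1 below
          \<open>n\<close> but at least 3 above it.\<close>
        ultimately have "Suc (Suc n') \<le> n \<or> Suc (Suc n) \<le> n'" by linarith
        then show ?thesis using n'(3) by auto
      qed
      then show ?thesis using f(6)[of x n] True by (simp add: letter_value_def)
    next
      case False
      then have "real (Suc n) \<in> J x" 
        using n x unfolding J_def by (intro image_eqI[of _ _ n]) auto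
      then have "f x (Suc n) = n" using f(5) by force
      moreover have "inj (f x)" using aut by (simp add: bij_is_inj)
      ultimately have "inv_into UNIV (f x) n = Suc n" by (intro inv_f_eq)
      then show ?thesis
        using False aut[of x] inv_order_aut_group[of "f x"] by (simp add: letter_value_def)
    qed
    then show ?case using n x IH by (simp add: take_Suc_conv_app_nth)
  qed simp
  from this[of "length v"] have "word_value order_aut_group f w 0 = length w" by (simp add: w)
  with aut f(3,4) out show ?thesis by (rule that)
qed

text \<open>The lower bound on \<open>f x\<close> is an upper bound on its inverse, so a letter of
  either sign raises a point by at most 1.\<close>

lemma word_value_displacement:
  fixes f :: "'a \<Rightarrow> real \<Rightarrow> real"
  assumes "\<And>x. f x \<in> carrier order_aut_group" "\<And>x t. t - 1 \<le> f x t" "\<And>x t. f x t \<le> t + 1"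
  shows "word_value order_aut_group f u t \<le> t + length u"
proof (induction u)
  case (Cons l u)
  have "letter_value order_aut_group f l s \<le> s + 1" for s
  proof (cases "snd l")
    case False
    have "bij (f (fst l))" using assms(1) by simp
    then have "f (fst l) (inv_into UNIV (f (fst l)) s) = s" by (simp add: bij_is_surj surj_f_inv_f)
    then have "inv_into UNIV (f (fst l)) s \<le> s + 1"
      using assms(2)[of "inv_into UNIV (f (fst l)) s" "fst l"] by simp
    then show ?thesis
      using False inv_order_aut_group[OF assms(1)] by (simp add: letter_value_def)
  qed (simp add: letter_value_def assms(3))
  from this[of "word_value order_aut_group f u t"] Cons show ?case by simp
qed simp

text \<open>An up-set that contains some value of \<open>f\<close> contains \<open>g\<close>. Hence
  the preimage of an open set is empty or omits only finitely many points, and finite sets are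
  closed in a \<open>T\<^sub>1\<close> space.\<close>

lemma continuous_map_cofinitely_max:
  fixes f :: "'a \<Rightarrow> 'b::order \<Rightarrow> 'b"
  assumes "t1_space X" "finite A" "\<And>x. x \<in> topspace X \<Longrightarrow> f x \<in> carrier order_aut_group"
    and max: "\<And>x. x \<in> topspace X \<Longrightarrow> f x \<le> g" and out: "\<And>x. x \<in> topspace X - A \<Longrightarrow> f x = g"
    and g: "g \<in> carrier order_aut_group"
  shows "continuous_map X order_aut_topology f"
  unfolding continuous_map_def topspace_order_aut_topology
proof (intro conjI allI impI)
  fix U :: "('b \<Rightarrow> 'b) set" assume U: "openin order_aut_topology U"
  show "openin X {x \<in> topspace X. f x \<in> U}"
  proof (cases "g \<in> U")
    case True
    then have "{x \<in> topspace X. f x \<in> U} = topspace X - {x \<in> topspace X \<inter> A. f x \<notin> U}"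
      using out by auto
    moreover have "closedin X {x \<in> topspace X \<inter> A. f x \<notin> U}"
      using assms(1,2) by (auto simp: t1_space_closedin_finite)
    ultimately show ?thesis by auto
  next
    case False
    then have "{x \<in> topspace X. f x \<in> U} = {}"
      using U max g by (auto simp: openin_order_aut_topology)
    then show ?thesis by (simp only: openin_empty)
  qed
qed (use assms(3) in auto)

lemma closedin_words_length_le:
  assumes "t1_space X"
  shows "closedin (free_topology X) {w \<in> reduced_words (topspace X). length w \<le> n}"
proof -
  have "\<exists>V. openin (free_topology X) V \<and> w \<in> V \<and> V \<subseteq> {w \<in> reduced_words (topspace X). n < length w}"
    if w: "w \<in> reduced_words (topspace X)" "n < length w" for w
  proof -
    obtain f :: "'a \<Rightarrow> real \<Rightarrow> real" where f: "\<And>x. f x \<in> carrier order_aut_group"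
      "\<And>x t. t - 1 \<le> f x t" "\<And>x t. f x t \<le> t + 1"
      "\<And>x. x \<notin> fst ` set w \<Longrightarrow> f x = (\<lambda>t. t + 1)"
      "word_value order_aut_group f w 0 = length w"
      using climbing_step_maps w(1) unfolding reduced_words_def by blast
    let ?\<phi> = "word_value order_aut_group f"
    \<comment> \<open>The climb puts the value of \<open>w\<close> in this up-set. The displacement
      bound lets in only words at least as long as \<open>w\<close>.\<close>
    let ?U = "{h \<in> carrier order_aut_group. real (length w) \<le> h (0::real)}"
    have shift: "(\<lambda>t::real. t + 1) \<in> carrier order_aut_group"
      by (rule order_aut_of_bounded_displacement[of _ 1])
         (auto intro!: continuous_intros strict_monoI)
    have cont: "continuous_map X order_aut_topology f"
      by (rule continuous_map_cofinitely_max[OF assms, of "fst ` set w" _ "\<lambda>t. t + 1"])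
         (use f shift in \<open>auto simp: le_fun_def simp del: order_aut_group_simps\<close>)
    have "openin order_aut_topology ?U"
      unfolding openin_order_aut_topology by (auto simp: le_fun_def intro: order_trans)
    then have "openin (free_topology X) {u \<in> topspace (free_topology X). ?\<phi> u \<in> ?U}"
      by (rule openin_continuous_map_preimage[OF
          free_topology_universal(2)[OF paratopological_group_order_aut cont]])
    moreover have "?\<phi> u \<in> carrier order_aut_group" if "u \<in> reduced_words (topspace X)" for u
      using that f(1) word_value_in[OF group_order_aut_group, of f "topspace X" u]
      unfolding reduced_words_def by blast
    moreover have "length w \<le> length u" if "real (length w) \<le> ?\<phi> u 0" for u
      using that word_value_displacement[of f u 0, OF f(1-3)] by linarith
    ultimately show ?thesis
      using w f(5)
      by (intro exI[of _ "{u \<in> topspace (free_topology X). ?\<phi> u \<in> ?U}"])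
         (force simp: topspace_free_topology simp del: order_aut_group_simps)
  qed
  then have "openin (free_topology X) {w \<in> reduced_words (topspace X). n < length w}"
    by (subst openin_subopen) blast
  moreover have "{w \<in> reduced_words (topspace X). n < length w} =
      topspace (free_topology X) - {w \<in> reduced_words (topspace X). length w \<le> n}"
    by (auto simp: topspace_free_topology)
  ultimately show ?thesis
    unfolding closedin_def by (auto simp: topspace_free_topology)
qed

section \<open>Coordinates on a free paratopological group\<close>

lemma embedding_map_imp_continuous_map: "embedding_map X T i \<Longrightarrow> continuous_map X T i"
  unfolding embedding_map_def using continuous_map_in_subtopology homeomorphic_imp_continuous_map by blast

text \<open>The extension \<open>h\<close> of the embedding of letters reads off the reduced word of
  an element. It transfers closed sets and uniqueness of words from the concrete free group to
  \<open>G\<close>.\<close>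

lemma free_paratopological_group_coordinates:
  assumes "free_paratopological_group X G T i"
  obtains h where "h \<in> hom G (free_group (topspace X))" "continuous_map T (free_topology X) h"
    "\<And>w. w \<in> reduced_words (topspace X) \<Longrightarrow> h (word_value G i w) = w"
    "word_value G i ` reduced_words (topspace X) = carrier G"
proof -
  let ?F = "free_group (topspace X)"
  have G: "group G" and T: "topspace T = carrier G" and emb: "embedding_map X T i"
    and gen: "generate G (i ` topspace X) = carrier G"
    using assms by (auto simp: free_paratopological_group_def paratopological_group_def)
  interpret G: group G by fact
  interpret F: group ?F by (rule group_free_group)
  have i: "i \<in> topspace X \<rightarrow> carrier G"
    using embedding_map_imp_continuous_map[OF emb] T by (auto simp: continuous_map_def)
  obtain h where h: "h \<in> hom G ?F" "continuous_map T (free_topology X) h"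
    "\<And>x. x \<in> topspace X \<Longrightarrow> h (i x) = [(x, True)]"
    using free_paratopological_group_universal[OF assms paratopological_group_free_topology
        embedding_map_imp_continuous_map[OF embedding_letter]] by auto
  interpret h: group_hom G ?F h using h(1) by unfold_locales
  have letter: "h (letter_value G i l) = [l]" if l: "fst l \<in> topspace X" for l
  proof (cases "snd l")
    case True
    then show ?thesis using h(3) l by (simp add: letter_value_def prod_eq_iff)
  next
    case False
    have "i (fst l) \<in> carrier G" using i l by blast
    then have "h (inv\<^bsub>G\<^esub> (i (fst l))) = [(fst l, False)]"
      using h.hom_inv h(3)[OF l] inv_letter[OF l] by metis
    then show ?thesis using False by (simp add: letter_value_def prod_eq_iff)
  qed
  have "h (word_value G i w) = w" if "w \<in> reduced_words (topspace X)" for w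
    using that
  proof (induction w)
    case Nil
    show ?case using h.hom_one by simp
  next
    case (Cons l w)
    then have w: "w \<in> reduced_words (topspace X)" and l: "fst l \<in> topspace X"
      and red: "reduced_word (l # w)"
      by (auto simp: reduced_words_def reduced_Cons)
    have "h (word_value G i (l # w)) = [l] \<otimes>\<^bsub>?F\<^esub> w"
      using h.hom_mult[OF letter_in[OF G i l] word_value_in[OF G i]] w Cons.IH letter[OF l]
      by (simp add: reduced_words_def)
    then show ?case using red by (simp add: push_eq_Cons)
  qed
  moreover have "word_value G i ` reduced_words (topspace X) = carrier G"
  proof
    show "word_value G i ` reduced_words (topspace X) \<subseteq> carrier G"
      using word_value_in[OF G i] by (auto simp: reduced_words_def)
    interpret v: group_hom ?F G "word_value G i"
      using word_value_hom[OF G i] by unfold_locales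
    \<comment> \<open>The image is a subgroup containing the generators, hence all of
      \<open>G\<close>.\<close>
    have "i x \<in> word_value G i ` reduced_words (topspace X)" if "x \<in> topspace X" for x
      using word_value_letter[OF G i that] letter_in_words[OF that] by (metis imageI)
    moreover have "subgroup (word_value G i ` reduced_words (topspace X)) G"
      using v.img_is_subgroup by simp
    ultimately show "carrier G \<subseteq> word_value G i ` reduced_words (topspace X)"
      using G.generate_subgroup_incl gen by (metis (no_types, lifting) image_subsetI)
  qed
  ultimately show ?thesis using that h by blast
qed

section \<open>Closures and translations\<close>

lemma continuous_map_translations:
  assumes "paratopological_group G T" "a \<in> carrier G" "b \<in> carrier G"
  shows "continuous_map T T (\<lambda>z. a \<otimes>\<^bsub>G\<^esub> z \<otimes>\<^bsub>G\<^esub> b)"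
proof -
  have T: "topspace T = carrier G"
    and mult: "continuous_map (prod_topology T T) T (\<lambda>(x, y). x \<otimes>\<^bsub>G\<^esub> y)"
    using assms by (auto simp: paratopological_group_def)
  have "continuous_map T T (\<lambda>z. f z \<otimes>\<^bsub>G\<^esub> g z)"
    if "continuous_map T T f" "continuous_map T T g" for f g
    using continuous_map_compose[OF continuous_map_pairedI[OF that] mult] by (simp add: o_def)
  then show ?thesis using assms T by simp
qed

lemma closure_of_translate:
  assumes "paratopological_group G T" "a \<in> carrier G" "b \<in> carrier G" "p \<in> T closure_of {q}"
  shows "a \<otimes>\<^bsub>G\<^esub> p \<otimes>\<^bsub>G\<^esub> b \<in> T closure_of {a \<otimes>\<^bsub>G\<^esub> q \<otimes>\<^bsub>G\<^esub> b}"
  using continuous_map_image_closure_subset[OF continuous_map_translations[OF assms(1-3)], of "{q}"]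
    assms(4) by auto

text \<open>Homogeneity: left translation by the inverse of \<open>g\<close> is continuous and pulls
  the singleton of the unit back to that of \<open>g\<close>.\<close>

lemma t1_space_paratopological_group:
  assumes G: "paratopological_group G T" and closed: "closedin T {\<one>\<^bsub>G\<^esub>}"
  shows "t1_space T"
  unfolding t1_space_closedin_singleton
proof
  fix g assume "g \<in> topspace T"
  interpret group G using G by (simp add: paratopological_group_def)
  have g: "g \<in> carrier G" and T: "topspace T = carrier G"
    using G \<open>g \<in> topspace T\<close> by (auto simp: paratopological_group_def)
  have "closedin T {z \<in> topspace T. inv\<^bsub>G\<^esub> g \<otimes>\<^bsub>G\<^esub> z \<otimes>\<^bsub>G\<^esub> \<one>\<^bsub>G\<^esub> \<in> {\<one>\<^bsub>G\<^esub>}}"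
    using g by (intro closedin_continuous_map_preimage[OF continuous_map_translations[OF G] closed]) auto
  moreover have "{z \<in> topspace T. inv\<^bsub>G\<^esub> g \<otimes>\<^bsub>G\<^esub> z \<otimes>\<^bsub>G\<^esub> \<one>\<^bsub>G\<^esub> \<in> {\<one>\<^bsub>G\<^esub>}} = {g}"
    using g T by (auto simp: inv_solve_left')
  ultimately show "closedin T {g}" by simp
qed

lemma t1_spaceI_closure_of:
  assumes "\<And>x y. x \<in> topspace X \<Longrightarrow> y \<in> topspace X \<Longrightarrow> x \<in> X closure_of {y} \<Longrightarrow> x = y"
  shows "t1_space X"
  unfolding t1_space_def
proof (intro ballI impI)
  fix x y assume "x \<in> topspace X" "y \<in> topspace X" "x \<noteq> y"
  then have "x \<notin> X closure_of {y}" using assms by blast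
  then show "\<exists>U. openin X U \<and> x \<in> U \<and> y \<notin> U"
    using \<open>x \<in> topspace X\<close> by (auto simp: in_closure_of)
qed

section \<open>Separation in a fixed free paratopological group\<close>

locale free_paratop =
  fixes X :: "'a topology" and G :: "('g, 'm) monoid_scheme" and T :: "'g topology"
    and i :: "'a \<Rightarrow> 'g"
  assumes free: "free_paratopological_group X G T i"
begin

lemma paratopological: "paratopological_group G T"
  using free by (simp add: free_paratopological_group_def)

sublocale group G
  using paratopological by (simp add: paratopological_group_def)

lemma topspace_T: "topspace T = carrier G"
  using paratopological by (simp add: paratopological_group_def)

lemma continuous_i: "continuous_map X T i"
  using free by (auto simp: free_paratopological_group_def intro: embedding_map_imp_continuous_map)

lemma i_closed: "x \<in> topspace X \<Longrightarrow> i x \<in> carrier G"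
  using continuous_i topspace_T by (auto simp: continuous_map_def)

lemma i_image_words: "i ` topspace X = word_value G i ` {[(x, True)] | x. x \<in> topspace X}"
proof -
  have "word_value G i [(x, True)] = i x" if "x \<in> topspace X" for x
    using i_closed[OF that] by (simp add: letter_value_def)
  then show ?thesis by (force simp del: word_value_simps)
qed

lemma inv_image_words:
  "(\<lambda>x. inv\<^bsub>G\<^esub> (i x)) ` topspace X = word_value G i ` {[(x, False)] | x. x \<in> topspace X}"
proof -
  have "word_value G i [(x, False)] = inv\<^bsub>G\<^esub> (i x)" if "x \<in> topspace X" for x
    using i_closed[OF that] by (simp add: letter_value_def)
  then show ?thesis by (force simp del: word_value_simps)
qed

text \<open>The image of \<open>C\<close> is its preimage under the continuous coordinate map
  \<open>h\<close>.\<close>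

lemma closedin_words:
  assumes "closedin (free_topology X) C"
  shows "closedin T (word_value G i ` C)"
proof -
  obtain h where h: "continuous_map T (free_topology X) h"
    "\<And>w. w \<in> reduced_words (topspace X) \<Longrightarrow> h (word_value G i w) = w"
    "word_value G i ` reduced_words (topspace X) = carrier G"
    by (rule free_paratopological_group_coordinates[OF free]) (rule that)
  have "C \<subseteq> reduced_words (topspace X)"
    using closedin_subset[OF assms] by (simp add: topspace_free_topology)
  then have "word_value G i ` C = {g \<in> word_value G i ` reduced_words (topspace X). h g \<in> C}"
    using h(2) by (auto simp: subset_iff)
  then have "word_value G i ` C = {g \<in> topspace T. h g \<in> C}"
    by (simp only: h(3) topspace_T)
  then show ?thesis using closedin_continuous_map_preimage[OF h(1) assms] by simp
qed

lemma word_value_inject: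
  assumes "u \<in> reduced_words (topspace X)" "v \<in> reduced_words (topspace X)"
    "word_value G i u = word_value G i v"
  shows "u = v"
  using free_paratopological_group_coordinates[OF free] assms by metis

lemma closedin_FP_le: "t1_space X \<Longrightarrow> closedin T (FP_le X G i n)"
  unfolding FP_le_def by (intro closedin_words closedin_words_length_le)

lemma inv_mult_in_closure_one:
  assumes "x \<in> topspace X" "y \<in> topspace X" "x \<in> X closure_of {y}"
  shows "inv\<^bsub>G\<^esub> (i y) \<otimes>\<^bsub>G\<^esub> i x \<in> T closure_of {\<one>\<^bsub>G\<^esub>}"
proof -
  have "i x \<in> T closure_of {i y}"
    using continuous_map_image_closure_subset[OF continuous_i, of "{y}"] assms(3) by auto
  from closure_of_translate[OF paratopological _ one_closed this, of "inv\<^bsub>G\<^esub> (i y)"]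
  show ?thesis using assms i_closed by simp
qed

text \<open>Common form of the converse implications: each refutes that y^-1 x lies in the closure
  of the unit for distinct points \<open>x\<close> and \<open>y\<close>.\<close>

lemma t1_spaceI:
  assumes "\<And>x y. x \<in> topspace X \<Longrightarrow> y \<in> topspace X \<Longrightarrow> x \<noteq> y \<Longrightarrow>
    inv\<^bsub>G\<^esub> (i y) \<otimes>\<^bsub>G\<^esub> i x \<in> T closure_of {\<one>\<^bsub>G\<^esub>} \<Longrightarrow> False"
  shows "t1_space X"
  using assms inv_mult_in_closure_one by (metis t1_spaceI_closure_of)

lemma closure_subset_closedin: "closedin T S \<Longrightarrow> g \<in> S \<Longrightarrow> T closure_of {g} \<subseteq> S"
  by (simp add: closure_of_minimal)

text \<open>Left translation by \<open>x\<close> puts the reduced word x y^-1 x of length 3 into the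
  closure of \<open>x\<close>, which stays among the generators.\<close>

lemma t1_space_if_closedin_generators:
  assumes "closedin T (i ` topspace X)"
  shows "t1_space X"
proof (rule t1_spaceI)
  fix x y assume xy: "x \<in> topspace X" "y \<in> topspace X" "x \<noteq> y"
    and c: "inv\<^bsub>G\<^esub> (i y) \<otimes>\<^bsub>G\<^esub> i x \<in> T closure_of {\<one>\<^bsub>G\<^esub>}"
  have "word_value G i [(x, True), (y, False), (x, True)] \<in> T closure_of {i x}"
    using closure_of_translate[OF paratopological _ one_closed c, of "i x"] xy i_closed
    by (simp add: letter_value_def)
  then have "word_value G i [(x, True), (y, False), (x, True)] \<in> i ` topspace X"
    using closure_subset_closedin[OF assms, of "i x"] xy by blast
  then obtain z where "z \<in> topspace X"
    "word_value G i [(x, True), (y, False), (x, True)] = word_value G i [(z, True)]"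
    unfolding i_image_words by blast
  then show False
    using word_value_inject[of "[(x, True), (y, False), (x, True)]" "[(z, True)]"] xy
    by (auto simp: reduced_words_def reduced_Cons flip_def)
qed

text \<open>Here right translation by y^-1 gives the reduced word y^-1 x y^-1 in the closure of
  y^-1.\<close>

lemma t1_space_if_closedin_inverses:
  assumes "closedin T ((\<lambda>x. inv\<^bsub>G\<^esub> (i x)) ` topspace X)"
  shows "t1_space X"
proof (rule t1_spaceI)
  fix x y assume xy: "x \<in> topspace X" "y \<in> topspace X" "x \<noteq> y"
    and c: "inv\<^bsub>G\<^esub> (i y) \<otimes>\<^bsub>G\<^esub> i x \<in> T closure_of {\<one>\<^bsub>G\<^esub>}"
  have "word_value G i [(y, False), (x, True), (y, False)] \<in> T closure_of {inv\<^bsub>G\<^esub> (i y)}"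
    using closure_of_translate[OF paratopological one_closed _ c, of "inv\<^bsub>G\<^esub> (i y)"] xy i_closed
    by (simp add: letter_value_def m_assoc)
  then have "word_value G i [(y, False), (x, True), (y, False)] \<in> (\<lambda>x. inv\<^bsub>G\<^esub> (i x)) ` topspace X"
    using closure_subset_closedin[OF assms, of "inv\<^bsub>G\<^esub> (i y)"] xy by blast
  then obtain z where "z \<in> topspace X"
    "word_value G i [(y, False), (x, True), (y, False)] = word_value G i [(z, False)]"
    unfolding inv_image_words by blast
  then show False
    using word_value_inject[of "[(y, False), (x, True), (y, False)]" "[(z, False)]"] xy
    by (auto simp: reduced_words_def reduced_Cons flip_def)
qed

lemma i_inject: "x \<in> topspace X \<Longrightarrow> y \<in> topspace X \<Longrightarrow> i x = i y \<Longrightarrow> x = y"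
  using word_value_inject[of "[(x, True)]" "[(y, True)]"]
  by (simp add: letter_in_words letter_value_def i_closed)

text \<open>Right translation by x^-1 puts y^-1 in the closure of x^-1: the closure relation
  reappears among the inverses, with \<open>x\<close> and \<open>y\<close> exchanged.\<close>

lemma t1_space_if_t1_inverses:
  assumes "t1_space (subtopology T ((\<lambda>x. inv\<^bsub>G\<^esub> (i x)) ` topspace X))" (is "t1_space ?S")
  shows "t1_space X"
proof (rule t1_spaceI)
  fix x y assume xy: "x \<in> topspace X" "y \<in> topspace X" "x \<noteq> y"
    and c: "inv\<^bsub>G\<^esub> (i y) \<otimes>\<^bsub>G\<^esub> i x \<in> T closure_of {\<one>\<^bsub>G\<^esub>}"
  have "inv\<^bsub>G\<^esub> (i y) \<in> T closure_of {inv\<^bsub>G\<^esub> (i x)}"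
    using closure_of_translate[OF paratopological one_closed _ c, of "inv\<^bsub>G\<^esub> (i x)"] xy i_closed
    by (simp add: m_assoc)
  moreover have "topspace ?S = (\<lambda>x. inv\<^bsub>G\<^esub> (i x)) ` topspace X"
    using i_closed by (auto simp: topspace_T)
  ultimately have "inv\<^bsub>G\<^esub> (i y) \<in> ?S closure_of {inv\<^bsub>G\<^esub> (i x)}"
    using xy by (auto simp: closure_of_subtopology)
  moreover have "closedin ?S {inv\<^bsub>G\<^esub> (i x)}"
    using assms xy \<open>topspace ?S = _\<close> unfolding t1_space_closedin_singleton by blast
  ultimately have "inv\<^bsub>G\<^esub> (i y) = inv\<^bsub>G\<^esub> (i x)" by (simp add: closure_of_closedin)
  then show False using xy i_closed i_inject by (metis inv_inv)
qed

text \<open>The powers of an element of the closure of the unit stay in that closure, but their word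
  lengths are unbounded.\<close>

lemma t1_space_if_closedin_FP_le:
  assumes "closedin T (FP_le X G i n)"
  shows "t1_space X"
proof (rule t1_spaceI)
  fix x y assume xy: "x \<in> topspace X" "y \<in> topspace X" "x \<noteq> y"
    and c: "inv\<^bsub>G\<^esub> (i y) \<otimes>\<^bsub>G\<^esub> i x \<in> T closure_of {\<one>\<^bsub>G\<^esub>}"
  \<comment> \<open>The reduced word of the \<open>k\<close>-th power of y^-1 x; nothing cancels
    because \<open>x\<close> and \<open>y\<close> differ.\<close>
  define W where "W k = concat (replicate k [(y, False), (x, True)])" for k :: nat
  have W_simps: "W 0 = []" "W (Suc k) = (y, False) # (x, True) # W k" for k
    by (simp_all add: W_def)
  have hd: "W k = [] \<or> hd (W k) = (y, False)" for k by (cases k) (auto simp: W_simps)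
  have W: "W k \<in> reduced_words (topspace X) \<and> length (W k) = 2 * k" for k
  proof (induction k)
    case (Suc k)
    then show ?case using xy hd[of k]
      by (auto simp: W_simps reduced_words_def reduced_Cons flip_def)
  qed (auto simp: W_simps reduced_words_def)
  have "word_value G i (W k) \<in> T closure_of {\<one>\<^bsub>G\<^esub>}" for k
  proof (induction k)
    case 0
    show ?case by (simp add: W_simps in_closure_of topspace_T)
  next
    case (Suc k)
    let ?p = "inv\<^bsub>G\<^esub> (i y) \<otimes>\<^bsub>G\<^esub> i x"
    have p: "?p \<in> carrier G" and Wk: "word_value G i (W k) \<in> carrier G"
      using xy i_closed Suc by (auto simp: in_closure_of topspace_T)
    have "word_value G i (W (Suc k)) \<in> T closure_of {?p}"
      using closure_of_translate[OF paratopological p one_closed Suc] p Wk xy i_closed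
      by (simp add: W_simps letter_value_def m_assoc)
    \<comment> \<open>Translating the previous power by \<open>?p\<close> only gives the closure of
      \<open>?p\<close>; this inclusion returns to the closure of the unit.\<close>
    moreover have "T closure_of {?p} \<subseteq> T closure_of {\<one>\<^bsub>G\<^esub>}"
      using c by (simp add: closure_subset_closedin)
    ultimately show ?case by blast
  qed
  moreover have "T closure_of {\<one>\<^bsub>G\<^esub>} \<subseteq> FP_le X G i n"
  proof (rule closure_subset_closedin[OF assms])
    show "\<one>\<^bsub>G\<^esub> \<in> FP_le X G i n"
      unfolding FP_le_def by (rule image_eqI[of _ _ "[]"]) (auto simp: reduced_words_def)
  qed
  \<comment> \<open>The length \<open>2 * Suc n\<close> exceeds \<open>n\<close> also when
    \<open>n\<close> is 0.\<close>
  ultimately have "word_value G i (W (Suc n)) \<in> FP_le X G i n" by blast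
  then obtain w where w: "w \<in> reduced_words (topspace X)" "length w \<le> n"
    "word_value G i (W (Suc n)) = word_value G i w"
    unfolding FP_le_def by blast
  then have "W (Suc n) = w" using word_value_inject W by blast
  then show False using w(2) W[of "Suc n"] by simp
qed

text \<open>The words of length 0 make up the singleton of the unit, so the case
  \<open>n = 0\<close> of \<open>closedin_FP_le\<close> suffices by homogeneity.\<close>

lemma t1_space_T:
  assumes "t1_space X"
  shows "t1_space T"
proof -
  have "{w \<in> reduced_words (topspace X). length w \<le> 0} = {[]}"
    by (auto simp: reduced_words_def)
  then have "FP_le X G i 0 = {\<one>\<^bsub>G\<^esub>}" by (simp add: FP_le_def)
  then show ?thesis
    using t1_space_paratopological_group[OF paratopological] closedin_FP_le[OF assms, of 0] by simp
qed

end

text \<open>Letters are separated from inverse letters and from the empty word by the exponent sum.\<close>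

lemma closedin_letters:
  assumes "t1_space X"
  shows "closedin (free_topology X) {[(x, b)] | x. x \<in> topspace X}"
proof -
  let ?Z = "discrete_topology (UNIV :: int set)"
  \<comment> \<open>The exponent sum is continuous into the discrete integers, so its fibres are
    closed. Among words of length at most 1 the value \<open>?s\<close> leaves exactly the letters
    of the chosen sign.\<close>
  let ?c = "word_value integer_group (\<lambda>x. 1)"
  let ?s = "if b then 1 else - 1 :: int"
  have "prod_topology ?Z ?Z = discrete_topology UNIV"
    by (metis UNIV_Times_UNIV prod_topology_discrete_topology)
  then have "paratopological_group integer_group ?Z"
    by (simp add: paratopological_group_def)
  then have "continuous_map (free_topology X) ?Z ?c"
    by (intro free_topology_universal(2)) auto
  then have "closedin (free_topology X) {w \<in> topspace (free_topology X). ?c w \<in> {?s}}"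
    by (rule closedin_continuous_map_preimage) auto
  then have "closedin (free_topology X) ({w \<in> reduced_words (topspace X). length w \<le> 1} \<inter>
      {w \<in> topspace (free_topology X). ?c w \<in> {?s}})"
    by (intro closedin_Int closedin_words_length_le assms)
  also have "{w \<in> reduced_words (topspace X). length w \<le> 1} \<inter>
      {w \<in> topspace (free_topology X). ?c w \<in> {?s}} = {[(x, b)] | x. x \<in> topspace X}" (is "?L = ?R")
  proof
    show "?L \<subseteq> ?R"
    proof
      fix w assume w: "w \<in> ?L"
      then have "w \<noteq> []" by (auto split: if_splits)
      then obtain x b' where "w = [(x, b')]" using w by (cases w) auto
      then show "w \<in> ?R" using w
        by (auto simp: reduced_words_def letter_value_def split: if_splits)
    qed
    show "?R \<subseteq> ?L"
      by (auto simp: topspace_free_topology letter_in_words letter_value_def)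
  qed
  finally show ?thesis .
qed

context free_paratop
begin

lemma discrete_inverses:
  assumes "t1_space X"
  defines "Xinv \<equiv> (\<lambda>x. inv\<^bsub>G\<^esub> (i x)) ` topspace X"
  shows "subtopology T Xinv = discrete_topology Xinv"
proof -
  have Xinv: "topspace T \<inter> Xinv = Xinv" using i_closed by (auto simp: Xinv_def topspace_T)
  have "openin (subtopology T Xinv) {inv\<^bsub>G\<^esub> (i x)}" if x: "x \<in> topspace X" for x
  proof -
    \<comment> \<open>Preimages of up-sets under \<open>f\<close> are empty, all of
      \<open>X\<close>, or the complement of \<open>x\<close>, hence open. The extension is 0 at
      x^-1 and -1 at every other inverse, so the up-set \<open>{0..}\<close> isolates x^-1.\<close>
    define f where "f y = (if y = x then 0 else 1 :: int)" for y
    have "openin X {y \<in> topspace X. f y \<in> U}" if U: "openin upper_topology U" for U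
    proof -
      have "openin X (topspace X - {x})"
        using assms(1) x by (auto simp: t1_space_closedin_singleton)
      moreover have "1 \<in> U" if "0 \<in> U" using that U by (auto simp: openin_upper_topology)
      then have "{y \<in> topspace X. f y \<in> U} =
          (if 0 \<in> U then topspace X else if 1 \<in> U then topspace X - {x} else {})"
        by (auto simp: f_def)
      ultimately show ?thesis by simp
    qed
    then have "continuous_map X upper_topology f" by (simp add: continuous_map_def)
    then obtain h where h: "h \<in> hom G integer_group" "continuous_map T upper_topology h"
      "\<And>y. y \<in> topspace X \<Longrightarrow> h (i y) = f y"
      using free_paratopological_group_universal[OF free paratopological_group_upper_topology] by blast
    interpret h: group_hom G integer_group h
      using h(1) by (simp add: group_hom_def group_hom_axioms_def is_group group_integer_group)
    have "openin T {g \<in> topspace T. h g \<in> {0..}}"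
      by (rule openin_continuous_map_preimage[OF h(2)]) (auto simp: openin_upper_topology)
    moreover have "{g \<in> topspace T. h g \<in> {0..}} \<inter> Xinv = {inv\<^bsub>G\<^esub> (i x)}"
      using x h(3) h.hom_inv i_closed
      by (auto simp: Xinv_def topspace_T f_def split: if_splits)
    ultimately show ?thesis by (metis openin_subtopology)
  qed
  then show ?thesis
    using Xinv by (intro discrete_topology_unique[THEN iffD2, symmetric]) (auto simp: Xinv_def)
qed

end

theorem theorem4p11:
  fixes X :: "'a topology"
    and FP :: "('g, 'm) monoid_scheme"
    and T :: "'g topology"
    and i :: "'a \<Rightarrow> 'g"
  assumes "free_paratopological_group X FP T i"
  defines "Xinv \<equiv> (\<lambda>x. inv\<^bsub>FP\<^esub> (i x)) ` topspace X"
  shows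
    "(t1_space X \<longleftrightarrow> t1_space T) \<and>
     (t1_space X \<longleftrightarrow> closedin T (i ` topspace X)) \<and>
     (t1_space X \<longleftrightarrow> subtopology T Xinv = discrete_topology Xinv) \<and>
     (t1_space X \<longleftrightarrow> t1_space (subtopology T Xinv)) \<and>
     (t1_space X \<longleftrightarrow> closedin T Xinv) \<and>
     (t1_space X \<longleftrightarrow> (\<forall>n. closedin T (FP_le X FP i n))) \<and>
     (t1_space X \<longleftrightarrow> (\<exists>n. closedin T (FP_le X FP i n)))"
proof -
  interpret free_paratop X FP T i by unfold_locales fact
  \<comment> \<open>The \<open>T\<^sub>1\<close> property of the whole group returns to
    \<open>X\<close> through the subspace of inverses.\<close>
  have sub: "t1_space (subtopology T Xinv)" if "t1_space T"
    using that by (rule t1_space_subtopology)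
  have disc: "t1_space (subtopology T Xinv)" if "subtopology T Xinv = discrete_topology Xinv"
    using that by (simp add: Hausdorff_imp_t1_space)
  have gen: "closedin T (i ` topspace X)" and inv: "closedin T Xinv" if "t1_space X"
    unfolding i_image_words Xinv_def inv_image_words
    by (intro closedin_words closedin_letters that)+
  show ?thesis
    using t1_space_T t1_space_if_closedin_generators gen discrete_inverses[folded Xinv_def] disc sub
      t1_space_if_t1_inverses[folded Xinv_def] t1_space_if_closedin_inverses[folded Xinv_def] inv
      closedin_FP_le t1_space_if_closedin_FP_le
    by blast
qed

end
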